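(* Let $q$ be an odd prime power, let $d$ be a positive integer with $q \equiv -1 \pmod d$, and let $c \in \mathbb{F}_{q^2}^*$. Let $r$ be a positive integer, let $k$ be an integer, and let $u=\frac{q+1}{d}+1$ and $u_1=(d-1)\frac{q+1}{d}+1$, where the exponents $u_1+k$ and $qu+2+k$ are supposed nonnegative. Let $$h(x)=c+x^{u_1+k}-x^{qu+2+k}\in\mathbb{F}_{q^2}[x].$$ Then $f(x)=x^r h(x^{q-1})$ is a permutation polynomial of $\mathbb{F}_{q^2}$ if and only if $\gcd(r,q^2-1)=1$.
   Context: $\mathbb{F}_{q^2}$ denotes the finite field with $q^2$ elements and $\mathbb{F}_{q^2}^*$ its set of nonzero elements. A polynomial $f\in\mathbb{F}_{q^2}[x]$ is a permutation polynomial of $\mathbb{F}_{q^2}$ if the map $a\mapsto f(a)$ from $\mathbb{F}_{q^2}$ to itself is a bijection. *)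

theory Defs
  imports
    "HOL-Library.Cardinality"
    "HOL-Computational_Algebra.Polynomial"
    "HOL-Number_Theory.Cong"
    "HOL-Number_Theory.Prime_Powers"
begin

definition permutation_polynomial :: "'a :: {field, finite} poly \<Rightarrow> bool" where
  "permutation_polynomial f \<longleftrightarrow> bij (poly f)"

end

theory Submission
  imports Defs
begin

text \<open>
  Write \<open>m = (q + 1) / d\<close>. The two exponents of \<open>h\<close> differ by \<open>(q + 1) m\<close>, so on the image of
  \<open>x \<mapsto> x^(q-1)\<close>, which consists of \<open>(q+1)\<close>-th roots of unity, the two monomials
  cancel and \<open>h\<close> is the constant \<open>c\<close>. Hence \<open>f\<close> induces the same map as \<open>c x^r\<close>.
\<close>

text \<open>Multiplication by \<open>x\<close> permutes the nonzero elements, so their product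
  \<open>?P\<close> is unchanged when every factor is multiplied by \<open>x\<close>; cancel
  \<open>?P\<close>, which is nonzero.\<close>

lemma finite_field_power_card_minus_1:
  fixes x :: "'a :: {field, finite}"
  assumes "x \<noteq> 0"
  shows "x ^ (CARD('a) - 1) = 1"
proof -
  let ?P = "\<Prod>y\<in>UNIV - {0 :: 'a}. y"
  have "bij_betw ((*) x) (UNIV - {0}) (UNIV - {0})"
    by (rule bij_betwI[where g = "\<lambda>y. y / x"]) (use assms in auto)
  then have "?P = (\<Prod>y\<in>UNIV - {0}. x * y)"
    by (rule prod.reindex_bij_betw[symmetric])
  also have "\<dots> = x ^ (CARD('a) - 1) * ?P"
    by (simp add: prod.distrib)
  finally show ?thesis
    by simp
qed

text \<open>Forwards, injectivity forces \<open>x ^ e = 1\<close> for all nonzero \<open>x\<close>,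
  where \<open>e\<close> is \<open>?N\<close> divided by \<open>gcd r ?N\<close>, and counting roots
  gives gcd 1. Backwards, a Bezout exponent inverts the power map.\<close>

lemma finite_field_bij_power_iff:
  assumes "r > 0"
  shows "bij (\<lambda>x :: 'a :: {field, finite}. x ^ r) \<longleftrightarrow> coprime r (CARD('a) - 1)"
proof
  let ?N = "CARD('a) - 1"
  have "card {0, 1 :: 'a} \<le> CARD('a)"
    by (intro card_mono) auto
  then have N: "?N > 0"
    by simp
  assume "bij (\<lambda>x :: 'a. x ^ r)"
  then have inj: "inj (\<lambda>x :: 'a. x ^ r)"
    by (rule bij_is_inj)
  obtain e where "?N = e * gcd r ?N"
    by (metis dvdE gcd_dvd2 mult.commute)
  with N have e: "e > 0" "?N = e * gcd r ?N"
    by (auto intro: Nat.gr0I)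
  obtain s where s: "r = gcd r ?N * s"
    by (metis dvdE gcd_dvd1)
  text \<open>All of the \<open>?N\<close> nonzero elements are roots of \<open>X^e - 1\<close>, which forces \<open>e = ?N\<close>.\<close>
  have root: "x ^ e = 1" if "x \<noteq> 0" for x :: 'a
  proof -
    \<comment> \<open>\<open>e * r\<close> is a multiple of \<open>?N\<close>, so
      \<open>x ^ e\<close> and 1 have the same \<open>r\<close>-th power.\<close>
    have "e * r = (e * gcd r ?N) * s"
      by (subst s) (rule mult.assoc[symmetric])
    then have "(x ^ e) ^ r = (x ^ (e * gcd r ?N)) ^ s"
      by (simp only: power_mult[symmetric])
    also have "\<dots> = 1 ^ r"
      using finite_field_power_card_minus_1[OF that] e by simp
    finally show ?thesis
      by (rule injD[OF inj])
  qed
  define p :: "'a poly" where "p = monom 1 e - 1"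
  have deg: "degree p \<le> e"
    unfolding p_def by (intro degree_diff_le) (auto simp: degree_monom_le)
  \<comment> \<open>Since \<open>e > 0\<close>, the constant term -1 does not meet the leading
    coefficient.\<close>
  have "coeff p e = 1"
    using e by (simp add: p_def coeff_monom)
  then have "p \<noteq> 0"
    by auto
  have "?N = card (UNIV - {0 :: 'a})"
    by simp
  also have "\<dots> \<le> card {x. poly p x = 0}"
    by (intro card_mono) (auto simp: p_def poly_monom root)
  also have "\<dots> \<le> degree p"
    by (rule card_poly_roots_bound) fact
  finally have "e * gcd r ?N \<le> e"
    using deg e(2) by linarith
  then have "gcd r ?N \<le> 1"
    using e(1) by simp
  moreover have "gcd r ?N > 0"
    using assms by (intro gcd_pos_nat[THEN iffD2]) simp
  ultimately show "coprime r ?N"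
    unfolding coprime_iff_gcd_eq_1 by linarith
next
  let ?N = "CARD('a) - 1"
  assume cop: "coprime r ?N"
  \<comment> \<open>Bezout over the naturals, possible as \<open>r > 0\<close>: raising to the power
    \<open>a\<close> undoes the \<open>r\<close>-th power on nonzero elements.\<close>
  obtain a b where ab: "r * a = ?N * b + 1"
    using bezout_nat[of r ?N] assms cop by auto
  have "inj (\<lambda>x :: 'a. x ^ r)"
  proof (rule injI)
    fix x y :: 'a
    assume eq: "x ^ r = y ^ r"
    have inverse: "(z ^ r) ^ a = z" if "z \<noteq> 0" for z :: 'a
    proof -
      have "(z ^ r) ^ a = (z ^ ?N) ^ b * z"
        by (simp only: power_mult[symmetric] ab power_add power_one_right)
      then show ?thesis
        using finite_field_power_card_minus_1[OF that] by simp
    qed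
    show "x = y"
    proof (cases "x = 0 \<or> y = 0")
      case True
      then show ?thesis
        using eq assms by (auto simp: power_0_left)
    next
      case False
      then show ?thesis
        using eq inverse by metis
    qed
  qed
  then show "bij (\<lambda>x :: 'a. x ^ r)"
    by (simp add: bij_def finite_UNIV_inj_surj)
qed

theorem theorem1p4:
  fixes q d r u u\<^sub>1 :: nat and k :: int
    and c :: "'a :: {field, finite}" and h f :: "'a poly"
  assumes "primepow q" and "odd q"
    and "CARD('a) = q\<^sup>2"
    and "d > 0" and "[int q = - 1] (mod int d)"
    and "c \<noteq> 0"
    and "r > 0"
    and "u = (q + 1) div d + 1"
    and "u\<^sub>1 = (d - 1) * ((q + 1) div d) + 1"
    and "int u\<^sub>1 + k \<ge> 0"
    and "int (q * u + 2) + k \<ge> 0"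
    and "h = [:c:] + monom 1 (nat (int u\<^sub>1 + k)) - monom 1 (nat (int (q * u + 2) + k))"
    and "f = monom 1 r * pcompose h (monom 1 (q - 1))"
  shows "permutation_polynomial f \<longleftrightarrow> gcd r (q\<^sup>2 - 1) = 1"
proof -
  define m where "m = (q + 1) div d"
  define a where "a = nat (int u\<^sub>1 + k)"
  have "int d dvd int (q + 1)"
    using assms(5) by (simp add: cong_iff_dvd_diff add.commute)
  then have dm: "q + 1 = d * m"
    unfolding m_def int_dvd_int_iff by (rule dvd_mult_div_cancel[symmetric])
  have "u\<^sub>1 + m = d * m + 1"
    using assms(4,9) by (cases d) (simp_all add: m_def)
  then have "u\<^sub>1 + m = q + 2"
    using dm by simp
  \<comment> \<open>As \<open>u = m + 1\<close>, the left side is \<open>q * m + (q + 2)\<close>,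
    and \<open>q + 2\<close> is \<open>u\<^sub>1 + m\<close>.\<close>
  then have "q * u + 2 = u\<^sub>1 + (q + 1) * m"
    using assms(8) unfolding m_def[symmetric] by (simp add: distrib_left distrib_right)
  then have "int (q * u + 2) + k = (int u\<^sub>1 + k) + int ((q + 1) * m)"
    by simp
  then have b: "nat (int (q * u + 2) + k) = a + (q + 1) * m"
    using assms(10) by (simp only: a_def nat_add_distrib of_nat_0_le_iff nat_int)
  have q2: "(q - 1) * (q + 1) = q\<^sup>2 - 1"
    by (cases q) (simp_all add: power2_eq_square)
  have f: "poly f x = c * x ^ r" for x
  \<comment> \<open>At 0 both sides vanish because \<open>r > 0\<close>; only for \<open>x\<close>
    nonzero is \<open>x ^ (q - 1)\<close> a root of unity.\<close>
  proof (cases "x = 0")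
    case True
    then show ?thesis
      using assms(7,13) by (simp add: poly_monom power_0_left)
  next
    case False
    define y where "y = x ^ (q - 1)"
    have "y ^ (q + 1) = x ^ (q\<^sup>2 - 1)"
      by (simp only: y_def power_mult[symmetric] q2)
    also have "\<dots> = 1"
      using finite_field_power_card_minus_1[OF False] assms(3) by simp
    finally have "y ^ (a + (q + 1) * m) = y ^ a"
      by (simp only: power_add[of y a] power_mult[of y "q + 1"] power_one mult_1_right)
    then have "poly h y = c"
      unfolding assms(12) b a_def[symmetric] by (simp add: poly_monom)
    then show ?thesis
      unfolding assms(13) by (simp add: poly_monom poly_pcompose y_def)
  qed
  have scale: "bij ((*) c)"
    by (rule bij_betwI[where g = "\<lambda>y. y / c"]) (use \<open>c \<noteq> 0\<close> in auto)
  \<comment> \<open>Scaling by \<open>c\<close> is a bijection, so it can be stripped off without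
    affecting bijectivity.\<close>
  have "poly f = (*) c \<circ> (\<lambda>x. x ^ r)"
    using f by auto
  then have "permutation_polynomial f \<longleftrightarrow> bij (\<lambda>x :: 'a. x ^ r)"
    unfolding permutation_polynomial_def
    using bij_betw_comp_iff2[OF scale, of "\<lambda>x. x ^ r" UNIV] by simp
  also have "\<dots> \<longleftrightarrow> gcd r (q\<^sup>2 - 1) = 1"
    using finite_field_bij_power_iff[OF \<open>r > 0\<close>, where ?'a = 'a] assms(3)
    by (simp add: coprime_iff_gcd_eq_1)
  finally show ?thesis .
qed

end
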